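(* Let $A\in\mathbb{R}_+^{\infty\times\infty}$ with $r_{ess}(A)<r(A)$. Then $r(A)\in\sigma_p(A)$.
   Context: $\mathbb{R}_+^{\infty\times\infty}$ is the set of infinite matrices $A=(a_{ij})_{i,j\in\mathbb{N}}$ with non-negative real entries and $\|A\|:=\sup\{a_{ij}:i,j\in\mathbb{N}\}<\infty$, where $\mathbb{N}=\{1,2,\dots\}$. $\ell^\infty_+$ is the set of bounded non-negative sequences. In max algebra, $(A\otimes B)_{ij}=\sup_{k}a_{ik}b_{kj}$, $(A\otimes x)_i=\sup_j a_{ij}x_j$, and $A^k_\otimes$ is the $k$-th power of $A$ for $\otimes$. The max-algebra spectral radius is $r(A)=\lim_{k\to\infty}\|A^k_\otimes\|^{1/k}=\inf_k\|A^k_\otimes\|^{1/k}$ (the limit exists). The point spectrum $\sigma_p(A)$ in max algebra is the set of all $t\ge0$ such that $A\otimes x=tx$ for some $x\in\ell^\infty_+$, $x\ne0$. For $n\in\mathbb{N}$, $P_n(x_1,x_2,\dots)=(0,\dots,0,x_{n+1},x_{n+2},\dots)$ (first $n$ coordinates replaced by $0$), so $P_nAP_n$ is $A$ with all entries having row or column index $\le n$ replaced by $0$; $r_{ess}(A)=\lim_{n\to\infty}r(P_nAP_n)=\inf_{n}r(P_nAP_n)$. *)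

theory Defs
  imports Complex_Main
begin

text \<open>
  Sequences and infinite matrices are functions on \<^typ>\<open>nat\<close>; indices start at 0, so index
  \<^term>\<open>i::nat\<close> here is index \<open>i + 1\<close> on paper.  All suprema are real suprema and are meaningful
  because they are taken over nonempty sets that are bounded above for matrices in
  \<open>bounded_nonneg_matrices\<close> and sequences in \<open>linf_nonneg\<close>.
\<close>

type_synonym inf_matrix = "nat \<Rightarrow> nat \<Rightarrow> real"

definition bounded_nonneg_matrices :: "inf_matrix set" where
  "bounded_nonneg_matrices = {A. (\<forall>i j. 0 \<le> A i j) \<and> bdd_above (range (\<lambda>(i, j). A i j))}"

definition mat_norm :: "inf_matrix \<Rightarrow> real" where
  "mat_norm A = (SUP (i, j). A i j)"

definition linf_nonneg :: "(nat \<Rightarrow> real) set" where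
  "linf_nonneg = {x. (\<forall>i. 0 \<le> x i) \<and> bdd_above (range x)}"

definition max_mult :: "inf_matrix \<Rightarrow> inf_matrix \<Rightarrow> inf_matrix" where
  "max_mult A B = (\<lambda>i j. SUP k. A i k * B k j)"

definition max_apply :: "inf_matrix \<Rightarrow> (nat \<Rightarrow> real) \<Rightarrow> nat \<Rightarrow> real" where
  "max_apply A x = (\<lambda>i. SUP j. A i j * x j)"

primrec max_power :: "inf_matrix \<Rightarrow> nat \<Rightarrow> inf_matrix" where
  "max_power A 0 = (\<lambda>i j. if i = j then 1 else 0)"
| "max_power A (Suc k) = max_mult A (max_power A k)"

definition max_spectral_radius :: "inf_matrix \<Rightarrow> real" where
  "max_spectral_radius A = lim (\<lambda>k. root k (mat_norm (max_power A k)))"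

definition max_point_spectrum :: "inf_matrix \<Rightarrow> real set" where
  "max_point_spectrum A =
     {t. 0 \<le> t \<and> (\<exists>x\<in>linf_nonneg. x \<noteq> (\<lambda>_. 0) \<and> max_apply A x = (\<lambda>i. t * x i))}"

definition tail_proj :: "nat \<Rightarrow> (nat \<Rightarrow> real) \<Rightarrow> nat \<Rightarrow> real" where
  "tail_proj n x = (\<lambda>i. if i < n then 0 else x i)"

text \<open>The matrix of the operator \<open>P\<^sub>n A P\<^sub>n\<close>, where \<open>P\<^sub>n\<close> is \<^term>\<open>tail_proj n\<close>.\<close>

definition tail_compression :: "nat \<Rightarrow> inf_matrix \<Rightarrow> inf_matrix" where
  "tail_compression n A = (\<lambda>i j. if i < n \<or> j < n then 0 else A i j)"

lemma max_apply_tail_compression: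
  "max_apply (tail_compression n A) x = tail_proj n (max_apply A (tail_proj n x))"
proof
  fix i
  have "(\<lambda>j. tail_compression n A i j * x j)
      = (if i < n then (\<lambda>_. 0) else (\<lambda>j. A i j * tail_proj n x j))"
    by (auto simp: tail_compression_def tail_proj_def)
  then have "max_apply (tail_compression n A) x i
      = (SUP j. (if i < n then (\<lambda>_. 0) else (\<lambda>j. A i j * tail_proj n x j)) j)"
    by (simp only: max_apply_def)
  then show "max_apply (tail_compression n A) x i = tail_proj n (max_apply A (tail_proj n x)) i"
    by (cases "i < n") (simp_all add: max_apply_def tail_proj_def)
qed

definition max_ess_spectral_radius :: "inf_matrix \<Rightarrow> real" where
  "max_ess_spectral_radius A = lim (\<lambda>n. max_spectral_radius (tail_compression n A))"

end

(*
  The spectral radius of B is the infimum of the levels t > 0 admitting a vector u, bounded and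
  bounded away from 0, with B u <= t u (max-algebra product). Let r = r(A) and let c be the last
  index with r(P_c A P_c) = r, which exists because r_ess(A) < r. Restoring the indices c, ..., 0
  one at a time preserves attainment of the level r, so A u <= r u for some such u. Let x be the
  least vector with A x <= r x and x_c >= 1. If row c of A x <= r x were strict, x could be combined
  with a strict vector of P_{c+1} A P_{c+1} to give r(P_c A P_c) < r; off c, equality
  holds by minimality, since a slack entry could be lowered.
*)

theory Submission
  imports Defs
begin

section \<open>Subinvariant vectors and the growth of max-algebra powers\<close>

text \<open>Entrywise form of \<open>max_apply B u\<close> \<le> t u that involves no supremum. With
  u bounded from both sides, conjugating B by the diagonal matrix of u changes the norms of all
  powers by a bounded factor only.\<close>

definition subinvariant :: "inf_matrix \<Rightarrow> real \<Rightarrow> (nat \<Rightarrow> real) \<Rightarrow> bool" where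
  "subinvariant B t u \<longleftrightarrow> (\<exists>a>0. \<exists>b. \<forall>i. a \<le> u i \<and> u i \<le> b) \<and> (\<forall>i j. B i j * u j \<le> t * u i)"

lemma subinvariant_mono:
  assumes "subinvariant B t u" "t \<le> t'" "\<And>i j. B' i j \<le> B i j"
  shows "subinvariant B' t' u"
proof -
  have pos: "0 < u i" for i
    using assms(1) unfolding subinvariant_def by (meson less_le_trans)
  have "B' i j * u j \<le> t' * u i" for i j
  proof -
    have "B' i j * u j \<le> B i j * u j"
      using assms(3) pos[of j] by (simp add: mult_right_mono)
    also have "\<dots> \<le> t * u i" using assms(1) by (simp add: subinvariant_def)
    also have "\<dots> \<le> t' * u i" using assms(2) pos[of i] by (simp add: mult_right_mono)
    finally show ?thesis .
  qed
  then show ?thesis using assms(1) by (auto simp: subinvariant_def)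
qed

lemma subinvariant_const:
  assumes "\<And>i j. B i j \<le> M"
  shows "subinvariant B M (\<lambda>_. 1)"
  unfolding subinvariant_def using assms by (auto intro!: exI[of _ 1])

text \<open>The upper estimate and nonnegativity go through one induction: the estimate bounds the
  set whose supremum defines the next power, and nonnegativity of that supremum can be read off a
  member only once the set is known to be bounded.\<close>

lemma subinvariant_max_power:
  assumes nn: "\<And>i j. 0 \<le> B i j" and u: "subinvariant B t u" and t: "0 < t"
  shows "0 \<le> max_power B n i j \<and> max_power B n i j * u j \<le> t ^ n * u i"
proof (induction n arbitrary: i j)
  case 0
  have "0 < u i" for i using u unfolding subinvariant_def by (meson less_le_trans)
  then show ?case by (simp add: less_imp_le)
next
  case (Suc n)
  have pos: "0 < u i" for i using u unfolding subinvariant_def by (meson less_le_trans)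
  have le: "B i k * max_power B n k j \<le> t ^ Suc n * u i / u j" for k
  proof -
    have "B i k * max_power B n k j * u j \<le> B i k * (t ^ n * u k)"
      using Suc.IH[of k j] nn[of i k] by (simp add: mult.assoc mult_left_mono)
    also have "\<dots> = t ^ n * (B i k * u k)" by simp
    also have "\<dots> \<le> t ^ n * (t * u i)"
      using u t by (intro mult_left_mono) (auto simp: subinvariant_def)
    finally show ?thesis using pos[of j] by (simp add: field_simps)
  qed
  have "max_power B (Suc n) i j \<le> t ^ Suc n * u i / u j"
    using le by (auto simp: max_mult_def intro!: cSUP_least)
  moreover have "B i 0 * max_power B n 0 j \<le> max_power B (Suc n) i j"
    unfolding max_power.simps max_mult_def
    by (rule cSUP_upper) (use le in \<open>auto intro!: bdd_aboveI\<close>)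
  moreover have "0 \<le> B i 0 * max_power B n 0 j" using nn Suc.IH by simp
  ultimately show ?case using pos[of j] by (simp add: field_simps del: max_power.simps)
qed

lemma max_power_bound:
  assumes nn: "\<And>i j. 0 \<le> B i j" and u: "subinvariant B t u" and t: "0 < t"
  obtains C where "0 < C" "\<And>n i j. 0 \<le> max_power B n i j" "\<And>n i j. max_power B n i j \<le> C * t ^ n"
proof -
  obtain a b where ab: "0 < a" "\<And>i. a \<le> u i" "\<And>i. u i \<le> b"
    using u unfolding subinvariant_def by blast
  have b: "0 < b" using ab(1) ab(2)[of 0] ab(3)[of 0] by linarith
  note * = subinvariant_max_power[OF nn u t]
  show thesis
  proof
    show "0 < b / a" using ab b by simp
    show "0 \<le> max_power B n i j" for n i j using * by blast
    show "max_power B n i j \<le> b / a * t ^ n" for n i j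
    proof -
      have "max_power B n i j * a \<le> max_power B n i j * u j"
        using * ab by (simp add: mult_left_mono)
      also have "\<dots> \<le> t ^ n * u i" using * by blast
      also have "\<dots> \<le> t ^ n * b" using ab t by simp
      finally show ?thesis using ab by (simp add: field_simps)
    qed
  qed
qed

lemma mult_max_power_le:
  assumes nn: "\<And>i j. 0 \<le> B i j" and M: "\<And>i j. B i j \<le> M" "0 < M"
  shows "B i j * max_power B n j p \<le> max_power B (Suc n) i p"
proof -
  obtain C where C: "0 < C" "\<And>n i j. 0 \<le> max_power B n i j" "\<And>n i j. max_power B n i j \<le> C * M ^ n"
    by (rule max_power_bound[OF nn subinvariant_const[of B, OF M(1)] M(2)], rule that)
  have "B i k * max_power B n k p \<le> M * (C * M ^ n)" for k
    using C M nn by (intro mult_mono) auto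
  then show ?thesis unfolding max_power.simps max_mult_def
    by (intro cSUP_upper) (auto intro!: bdd_aboveI)
qed

text \<open>The vector is the maximum of \<open>t\<^sup>-\<^sup>l B\<^sup>l \<otimes> (1, 1, \<dots>)\<close> over \<open>l < k\<close>.\<close>

lemma subinvariant_of_power_bound:
  assumes nn: "\<And>i j. 0 \<le> B i j" and M: "\<And>i j. B i j \<le> M"
    and k: "0 < k" and t: "0 < t" and le: "\<And>i j. max_power B k i j \<le> t ^ k"
  shows "\<exists>u. subinvariant B t u"
proof -
  \<comment> \<open>With T \<ge> t the powers of T / t do not decrease, so all terms with l < k
    share one upper bound.\<close>
  define T where "T = max M t"
  have T: "\<And>i j. B i j \<le> T" "0 < T" "t \<le> T"
    using M t by (auto simp: T_def le_max_iff_disj)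
  obtain C where C: "0 < C" "\<And>n i j. 0 \<le> max_power B n i j" "\<And>n i j. max_power B n i j \<le> C * T ^ n"
    by (rule max_power_bound[OF nn subinvariant_const[of B, OF T(1)] T(2)], rule that)
  define h where "h l i = (SUP j. max_power B l i j)" for l i
  have bdd: "bdd_above (range (max_power B l i))" for l i
    using C(3) by (auto intro!: bdd_aboveI)
  have h_up: "max_power B l i j \<le> h l i" for l i j
    unfolding h_def by (rule cSUP_upper) (use bdd in auto)
  have h_le: "h l i \<le> C * T ^ l" for l i
    unfolding h_def by (rule cSUP_least) (use C in auto)
  have h_k: "h k i \<le> t ^ k" for i
    unfolding h_def by (rule cSUP_least) (use le in auto)
  have h0: "1 \<le> h 0 i" for i using h_up[of 0 i i] by simp
  have h_step: "B i j * h l j \<le> h (Suc l) i" for i j l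
  proof (cases "B i j = 0")
    case True
    have "0 \<le> h (Suc l) i" using h_up[of "Suc l" i 0] C(2)[of "Suc l" i 0] by linarith
    then show ?thesis using True by simp
  next
    case False
    then have pos: "0 < B i j" using nn[of i j] by simp
    have "max_power B l j p \<le> h (Suc l) i / B i j" for p
      using mult_max_power_le[of B, OF nn T(1,2), of i j l p] h_up[of "Suc l" i p] pos
      by (simp add: field_simps del: max_power.simps)
    then have "h l j \<le> h (Suc l) i / B i j"
      unfolding h_def[of l] by (intro cSUP_least) auto
    then show ?thesis using pos by (simp add: field_simps)
  qed
  define u where "u i = Max ((\<lambda>l. h l i / t ^ l) ` {..<k})" for i
  have u_up: "h l i / t ^ l \<le> u i" if "l < k" for l i
    unfolding u_def using that by (intro Max_ge) auto
  have u1: "1 \<le> u i" for i using u_up[of 0 i] h0[of i] k by simp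
  have ub: "u i \<le> C * (T / t) ^ k" for i
    unfolding u_def
  proof (rule Max.boundedI)
    fix z assume "z \<in> (\<lambda>l. h l i / t ^ l) ` {..<k}"
    then obtain l where l: "l < k" "z = h l i / t ^ l" by auto
    have "z \<le> C * (T / t) ^ l"
      using h_le[of l i] t l by (simp add: power_divide divide_right_mono)
    also have "\<dots> \<le> C * (T / t) ^ k"
      using C l T t by (intro mult_left_mono power_increasing) auto
    finally show "z \<le> C * (T / t) ^ k" .
  qed (use k in auto)
  have "B i j * u j \<le> t * u i" for i j
  proof -
    have "u j \<in> (\<lambda>l. h l j / t ^ l) ` {..<k}"
      unfolding u_def using k by (intro Max_in) auto
    then obtain l where l: "l < k" "u j = h l j / t ^ l" by auto
    have "B i j * u j = B i j * h l j / t ^ l" using l by simp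
    also have "\<dots> \<le> h (Suc l) i / t ^ l" using h_step t by (simp add: divide_right_mono)
    also have "\<dots> = t * (h (Suc l) i / t ^ Suc l)" using t by simp
    also have "\<dots> \<le> t * u i"
    proof (cases "Suc l < k")
      case True
      then show ?thesis using u_up[of "Suc l" i] t by (intro mult_left_mono) auto
    next
      \<comment> \<open>The maximum closes up here: h k i / t^k is at most 1, and the term l = 0 is
        already at least 1 because \<open>max_power B 0\<close> is the identity.\<close>
      case False
      then have "Suc l = k" using l by simp
      then have "h (Suc l) i / t ^ Suc l \<le> 1" using h_k[of i] t by simp
      then show ?thesis using u1[of i] t by (intro mult_left_mono) linarith+
    qed
    finally show ?thesis .
  qed
  then show ?thesis using u1 ub unfolding subinvariant_def by (meson zero_less_one)
qed

section \<open>The spectral radius as an infimum of levels\<close>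

text \<open>If a k-th root with k \<ge> 1 were at most some t > 0 below the infimum,
  \<open>subinvariant_of_power_bound\<close> would put t into the set. For t in the set the k-th
  roots are at most \<open>root k C * t\<close>, and \<open>root k C\<close> tends to 1. Hence the
  limit exists and \<open>lim\<close> denotes it.\<close>

lemma max_spectral_radius_eq_Inf:
  assumes nn: "\<And>i j. 0 \<le> B i j" and M: "\<And>i j. B i j \<le> M"
  shows "max_spectral_radius B = Inf {t. 0 < t \<and> (\<exists>u. subinvariant B t u)}" (is "_ = Inf ?S")
proof -
  define T where "T = max M 1"
  have T: "\<And>i j. B i j \<le> T" "0 < T" using M by (auto simp: T_def le_max_iff_disj)
  have "T \<in> ?S" using subinvariant_const[of B T, OF T(1)] T(2) by blast
  then have ne: "?S \<noteq> {}" by blast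
  have bb: "bdd_below ?S" by (rule bdd_belowI[of _ 0]) auto
  have L0: "0 \<le> Inf ?S" using ne by (intro cInf_greatest) auto
  obtain C0 where C0: "0 < C0" "\<And>n i j. 0 \<le> max_power B n i j" "\<And>n i j. max_power B n i j \<le> C0 * T ^ n"
    by (rule max_power_bound[OF nn subinvariant_const[of B, OF T(1)] T(2)], rule that)
  have up: "max_power B k i j \<le> mat_norm (max_power B k)" for k i j
  proof -
    have "bdd_above (range (\<lambda>(i, j). max_power B k i j))"
      using C0(3) by (intro bdd_aboveI2[of _ _ "C0 * T ^ k"]) (simp add: case_prod_beta)
    then show ?thesis
      using cSUP_upper[of "(i, j)" UNIV "\<lambda>(i, j). max_power B k i j"] by (simp add: mat_norm_def)
  qed
  have norm0: "0 \<le> mat_norm (max_power B k)" for k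
    using up[of k 0 0] C0(2)[of k 0 0] by linarith
  have "(\<lambda>k. root k (mat_norm (max_power B k))) \<longlonglongrightarrow> Inf ?S"
  proof (rule order_tendstoI)
    fix s assume s: "s < Inf ?S"
    show "\<forall>\<^sub>F k in sequentially. s < root k (mat_norm (max_power B k))"
    \<comment> \<open>At k = 0 the root is 0 by convention and says nothing about the norm.\<close>
    proof (rule eventually_sequentiallyI[of 1])
      fix k :: nat assume k: "1 \<le> k"
      show "s < root k (mat_norm (max_power B k))"
      proof (cases "s < 0")
        case True
        have "0 \<le> root k (mat_norm (max_power B k))" using norm0 by (rule real_root_ge_zero)
        with True show ?thesis by linarith
      next
        case False
        obtain t where t: "s < t" "t < Inf ?S" using s dense by blast
        then have tpos: "0 < t" using False by simp
        have "t < root k (mat_norm (max_power B k))"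
        proof (rule ccontr)
          assume "\<not> ?thesis"
          then have "root k (mat_norm (max_power B k)) ^ k \<le> t ^ k"
            using norm0 by (intro power_mono real_root_ge_zero) auto
          then have "mat_norm (max_power B k) \<le> t ^ k" using k norm0 by simp
          then have "max_power B k i j \<le> t ^ k" for i j using up[of k i j] by linarith
          then have "\<exists>u. subinvariant B t u"
            using subinvariant_of_power_bound[of B M k t] nn M tpos k by simp
          then have "Inf ?S \<le> t" using tpos by (intro cInf_lower[OF _ bb]) simp
          then show False using t by simp
        qed
        then show ?thesis using t by simp
      qed
    qed
  next
    fix s assume "Inf ?S < s"
    then obtain t where t: "t \<in> ?S" "t < s" using cInf_lessD[OF ne] by blast
    then obtain u where u: "subinvariant B t u" "0 < t" by blast
    obtain C where C: "0 < C" "\<And>n i j. max_power B n i j \<le> C * t ^ n"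
      by (rule max_power_bound[OF nn u], rule that)
    have "(\<lambda>k. root k C * t) \<longlonglongrightarrow> 1 * t"
      using C by (intro tendsto_intros LIMSEQ_root_const)
    then have "\<forall>\<^sub>F k in sequentially. root k C * t < s"
      using t by (intro order_tendstoD(2)) auto
    then show "\<forall>\<^sub>F k in sequentially. root k (mat_norm (max_power B k)) < s"
      using eventually_gt_at_top[of "0::nat"]
    proof eventually_elim
      case (elim k)
      have "mat_norm (max_power B k) \<le> C * t ^ k"
        unfolding mat_norm_def using C by (intro cSUP_least) auto
      then have "root k (mat_norm (max_power B k)) \<le> root k (C * t ^ k)"
        using elim by simp
      also have "\<dots> = root k C * t"
        using elim u by (simp add: real_root_mult real_root_power_cancel)
      finally show ?case using elim by simp
    qed
  qed
  then show ?thesis unfolding max_spectral_radius_def by (rule limI)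
qed

text \<open>Below, the radius is handled only through these facts. A vector is promised only
  strictly above the radius; the radius itself need not admit one.\<close>

lemma max_spectral_radius_bounds:
  assumes nn: "\<And>i j. 0 \<le> B i j" and M: "\<And>i j. B i j \<le> M"
  shows max_spectral_radius_nonneg: "0 \<le> max_spectral_radius B"
    and max_spectral_radius_le: "\<And>t u. 0 < t \<Longrightarrow> subinvariant B t u \<Longrightarrow> max_spectral_radius B \<le> t"
    and max_spectral_radius_less: "\<And>t. max_spectral_radius B < t \<Longrightarrow> \<exists>u. subinvariant B t u"
proof -
  let ?S = "{t. 0 < t \<and> (\<exists>u. subinvariant B t u)}"
  note eq = max_spectral_radius_eq_Inf[of B, OF nn M]
  have "B i j \<le> max M 1" for i j using M[of i j] by simp
  from subinvariant_const[of B, OF this] have "max M 1 \<in> ?S" by auto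
  then have ne: "?S \<noteq> {}" by blast
  have bb: "bdd_below ?S" by (rule bdd_belowI[of _ 0]) auto
  show "0 \<le> max_spectral_radius B" unfolding eq using ne by (intro cInf_greatest) auto
  show "max_spectral_radius B \<le> t" if "0 < t" "subinvariant B t u" for t u
    unfolding eq using that bb by (intro cInf_lower) auto
  show "\<exists>u. subinvariant B t u" if "max_spectral_radius B < t" for t
  proof -
    have "Inf ?S < t" using that eq by simp
    then obtain s where "s \<in> ?S" "s < t" using cInf_lessD[OF ne] by blast
    then show ?thesis using subinvariant_mono[of B s _ t B] by auto
  qed
qed

section \<open>Attaining the critical level after restoring one index\<close>

text \<open>
  Truncating the vectors at levels \<open>t > r\<close> by a multiple of \<open>v\<close>, with value \<open>1\<close> at \<open>c\<close>, makes them
  uniformly bounded; their lower limit as \<open>t\<close> tends to \<open>r\<close> works at level \<open>r\<close>.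
\<close>

lemma subinvariant_extend:
  assumes nn: "\<And>i j. 0 \<le> D i j" and M: "\<And>i j. D i j \<le> M"
    and r: "0 < r" and v: "subinvariant E r v"
    and E: "\<And>i j. i \<noteq> c \<Longrightarrow> j \<noteq> c \<Longrightarrow> D i j \<le> E i j"
    and t: "\<And>t. r < t \<Longrightarrow> \<exists>u. subinvariant D t u"
  shows "\<exists>u. subinvariant D r u"
proof -
  have M0: "0 \<le> M" using nn M order_trans by blast
  obtain a b where ab: "0 < a" "\<And>i. a \<le> v i" "\<And>i. v i \<le> b"
    using v unfolding subinvariant_def by blast
  have vpos: "0 < v i" for i using ab(1) ab(2)[of i] by linarith
  have Dv: "D i j * v j \<le> r * v i" if "i \<noteq> c" "j \<noteq> c" for i j
  proof -
    have "D i j * v j \<le> E i j * v j" using E that vpos[of j] by (simp add: mult_right_mono)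
    also have "\<dots> \<le> r * v i" using v by (simp add: subinvariant_def)
    finally show ?thesis .
  qed
  \<comment> \<open>Large enough for K v to absorb column c when the entry at c is 1.\<close>
  define K where "K = M / (r * a)"
  have K0: "0 \<le> K" using M0 r ab by (simp add: K_def)
  have K: "D i c \<le> r * (K * v i)" for i
  proof -
    have "D i c \<le> r * (K * a)" using M r ab by (simp add: K_def)
    also have "\<dots> \<le> r * (K * v i)" using ab K0 r by (simp add: mult_left_mono)
    finally show ?thesis .
  qed
  define \<tau> where "\<tau> n = r + inverse (real (Suc n))" for n
  have \<tau>: "r < \<tau> n" "0 < \<tau> n" for n using r by (auto simp: \<tau>_def add_pos_pos)
  have \<tau>mono: "\<tau> (n + m) \<le> \<tau> n" for n m by (simp add: \<tau>_def field_simps)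
  have \<tau>lim: "\<tau> \<longlonglongrightarrow> r"
    unfolding \<tau>_def using tendsto_add[OF tendsto_const LIMSEQ_inverse_real_of_nat] by simp
  have "\<forall>n. \<exists>u. subinvariant D (\<tau> n) u" using t \<tau> by blast
  then obtain u where u: "\<And>n. subinvariant D (\<tau> n) (u n)" by metis
  have upos: "0 < u n i" for n i using u[of n] unfolding subinvariant_def by (meson less_le_trans)
  \<comment> \<open>Row c inherits its inequality because truncation only lowers the other entries.
    In any other row both terms of the minimum satisfy the estimate. The bound K v does not depend
    on n.\<close>
  define p where "p n i = (if i = c then 1 else min (u n i / u n c) (K * v i))" for n i
  have pu: "p n i \<le> u n i / u n c" for n i using upos[of n c] by (simp add: p_def)
  have p0: "0 \<le> p n i" for n i using upos[of n c] upos[of n i] K0 vpos[of i] by (simp add: p_def)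
  have pb: "p n i \<le> max 1 (K * b)" for n i
  proof -
    have "K * v i \<le> K * b" using K0 ab by (simp add: mult_left_mono)
    then show ?thesis by (auto simp: p_def min_le_iff_disj le_max_iff_disj)
  qed
  have Dp: "D i j * p n j \<le> \<tau> n * p n i" for n i j
  proof -
    have "D i j * p n j \<le> D i j * (u n j / u n c)" using pu nn by (intro mult_left_mono) auto
    also have "\<dots> = D i j * u n j / u n c" by simp
    also have "\<dots> \<le> \<tau> n * u n i / u n c"
      using u[of n] upos[of n c] by (intro divide_right_mono) (auto simp: subinvariant_def)
    finally have 1: "D i j * p n j \<le> \<tau> n * (u n i / u n c)" by simp
    show ?thesis
    proof (cases "i = c")
      case True
      then show ?thesis using 1 upos[of n c] by (simp add: p_def)
    next
      case False
      have "D i j * p n j \<le> r * (K * v i)"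
      proof (cases "j = c")
        case True
        then show ?thesis using K by (simp add: p_def)
      next
        case jc: False
        have "D i j * p n j \<le> D i j * (K * v j)"
          using nn jc by (intro mult_left_mono) (auto simp: p_def)
        also have "\<dots> = K * (D i j * v j)" by simp
        also have "\<dots> \<le> K * (r * v i)" using Dv False jc K0 by (intro mult_left_mono) auto
        finally show ?thesis by (simp add: algebra_simps)
      qed
      also have "\<dots> \<le> \<tau> n * (K * v i)"
        using \<tau>(1)[of n] K0 vpos[of i] by (intro mult_right_mono) auto
      finally show ?thesis using 1 False \<tau>(2)[of n]
        by (simp add: p_def min_mult_distrib_left)
    qed
  qed
  \<comment> \<open>Infima over tails increase with n, so their limit is the lower limit of p, and
    the inequalities pass to it without extracting a subsequence.\<close>
  define q where "q n i = (INF m. p (n + m) i)" for n i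
  have pbb: "bdd_below (range (\<lambda>m. p (n + m) i))" for n i
    using p0 by (auto intro!: bdd_belowI)
  have q_low: "q n i \<le> p (n + m) i" for n m i
    unfolding q_def by (rule cINF_lower) (use pbb in auto)
  have q0: "0 \<le> q n i" for n i unfolding q_def using p0 by (intro cINF_greatest) auto
  have qb: "q n i \<le> max 1 (K * b)" for n i
    using q_low[of n i 0] pb[of n i] by simp
  have qc: "q n c = 1" for n by (simp add: q_def p_def)
  have qmono: "incseq (\<lambda>n. q n i)" for i
  proof (rule incseq_SucI)
    fix n
    show "q n i \<le> q (Suc n) i"
      unfolding q_def[of "Suc n"] using q_low[of n i "Suc _"] by (intro cINF_greatest) auto
  qed
  have Dq: "D i j * q n j \<le> \<tau> n * q n i" for n i j
  proof -
    have "D i j * q n j / \<tau> n \<le> p (n + m) i" for m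
    proof -
      have "D i j * q n j \<le> D i j * p (n + m) j" using q_low nn by (intro mult_left_mono) auto
      also have "\<dots> \<le> \<tau> (n + m) * p (n + m) i" by (rule Dp)
      also have "\<dots> \<le> \<tau> n * p (n + m) i" using \<tau>mono p0 by (intro mult_right_mono) auto
      finally show ?thesis using \<tau>(2)[of n] by (simp add: field_simps)
    qed
    then have "D i j * q n j / \<tau> n \<le> q n i" unfolding q_def[of n i] by (intro cINF_greatest) auto
    then show ?thesis using \<tau>(2)[of n] by (simp add: field_simps)
  qed
  define y where "y i = (SUP n. q n i)" for i
  have ylim: "(\<lambda>n. q n i) \<longlonglongrightarrow> y i" for i
    unfolding y_def using qb qmono by (intro LIMSEQ_incseq_SUP) (auto intro!: bdd_aboveI)
  have Dy: "D i j * y j \<le> r * y i" for i j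
    by (rule LIMSEQ_le[OF tendsto_mult[OF tendsto_const ylim] tendsto_mult[OF \<tau>lim ylim]])
       (use Dq in auto)
  have y0: "0 \<le> y i" for i by (rule LIMSEQ_le_const[OF ylim]) (use q0 in auto)
  have yb: "y i \<le> max 1 (K * b)" for i by (rule LIMSEQ_le_const2[OF ylim]) (use qb in auto)
  have yc: "y c = 1" by (simp add: y_def qc)
  \<comment> \<open>y may have zero or arbitrarily small entries, so a multiple of v is put under
    it. Row c is not controlled by v, but the entry 1 at c leaves room for a small multiple. The
    summand 1 keeps the denominator positive.\<close>
  define \<delta> where "\<delta> = r / (M * b + 1)"
  have b: "0 < b" using ab(1) ab(2)[of 0] ab(3)[of 0] by linarith
  have Mb: "0 \<le> M * b" using M0 b by simp
  have \<delta>: "0 < \<delta>" using r Mb by (simp add: \<delta>_def add_nonneg_pos)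
  have \<delta>c: "D c j * (\<delta> * v j) \<le> r" for j
  proof -
    have "D c j * (\<delta> * v j) = (D c j * v j) * \<delta>" by simp
    also have "\<dots> \<le> (M * b + 1) * \<delta>"
      using \<delta> mult_mono[OF M[of c j] ab(3)[of j] M0] vpos[of j] by (intro mult_right_mono) auto
    also have "\<dots> = r" using Mb by (simp add: \<delta>_def)
    finally show ?thesis .
  qed
  define w where "w i = (if i = c then 1 else max (y i) (\<delta> * v i))" for i
  have yw: "y i \<le> w i" for i by (simp add: w_def yc)
  have "D i j * w j \<le> r * w i" for i j
  proof -
    have 1: "D i j * y j \<le> r * w i"
      using Dy[of i j] mult_left_mono[OF yw[of i], of r] r by linarith
    show ?thesis
    proof (cases "j = c \<or> \<delta> * v j \<le> y j")
      case True
      then have "w j = y j" by (auto simp: w_def yc)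
      then show ?thesis using 1 by simp
    next
      case False
      then have wj: "w j = \<delta> * v j" by (simp add: w_def)
      show ?thesis
      proof (cases "i = c")
        case True
        then show ?thesis using \<delta>c[of j] wj by (simp add: w_def)
      next
        case ic: False
        have "D i j * w j = \<delta> * (D i j * v j)" using wj by simp
        also have "\<dots> \<le> \<delta> * (r * v i)" using Dv ic False \<delta> by (intro mult_left_mono) auto
        also have "\<dots> \<le> r * w i" using ic r by (simp add: w_def)
        finally show ?thesis .
      qed
    qed
  qed
  moreover have "min 1 (\<delta> * a) \<le> w i" for i
  proof -
    have "\<delta> * a \<le> \<delta> * v i" using \<delta> ab by (intro mult_left_mono) auto
    then show ?thesis by (auto simp: w_def min_le_iff_disj le_max_iff_disj)
  qed
  moreover have "w i \<le> max (max 1 (K * b)) (\<delta> * b)" for i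
  proof -
    have "\<delta> * v i \<le> \<delta> * b" using \<delta> ab by (intro mult_left_mono) auto
    then show ?thesis using yb[of i] by (auto simp: w_def le_max_iff_disj)
  qed
  moreover have "0 < min 1 (\<delta> * a)" using \<delta> ab by simp
  ultimately show ?thesis unfolding subinvariant_def by blast
qed

section \<open>Making all rows strict by geometric means\<close>

text \<open>Split d as \<open>d powr \<theta> * d powr (1 - \<theta>)\<close> and multiply the
  corresponding powers of the two inequalities. Since a row condition consists of single-entry
  inequalities, without sums, the levels of two vectors interpolate row by row.\<close>

lemma geometric_mean_le:
  fixes d :: real
  assumes "0 \<le> d" "0 < y" "0 < v" "0 < y'" "0 < v'" "0 < \<alpha>" "0 < \<beta>" "0 < \<theta>" "\<theta> < 1"
    and y: "d * y \<le> \<alpha> * y'" and v: "d * v \<le> \<beta> * v'"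
  shows "d * (y powr \<theta> * v powr (1 - \<theta>))
    \<le> (\<alpha> powr \<theta> * \<beta> powr (1 - \<theta>)) * (y' powr \<theta> * v' powr (1 - \<theta>))"
proof -
  have "d = d powr \<theta> * d powr (1 - \<theta>)" using assms(1) by (simp flip: powr_add)
  then have "d * (y powr \<theta> * v powr (1 - \<theta>)) = (d * y) powr \<theta> * (d * v) powr (1 - \<theta>)"
    using assms by (simp add: powr_mult)
  also have "\<dots> \<le> (\<alpha> * y') powr \<theta> * (\<beta> * v') powr (1 - \<theta>)"
    using assms by (intro mult_mono[of "_ powr _"] powr_mono2) auto
  also have "\<dots> = (\<alpha> powr \<theta> * \<beta> powr (1 - \<theta>)) * (y' powr \<theta> * v' powr (1 - \<theta>))"
    using assms by (simp add: powr_mult)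
  finally show ?thesis .
qed

text \<open>
  The vector \<open>v\<close> is strict in every row but \<open>c\<close>, and \<open>y\<close> is strict in row \<open>c\<close>; a weighted geometric
  mean of the two, with weight close to \<open>1\<close> on \<open>y\<close>, is strict in all rows.
\<close>

lemma subinvariant_strict:
  assumes nn: "\<And>i j. 0 \<le> D i j" and M: "\<And>i j. D i j \<le> M"
    and t: "0 < t" "t < r" and v: "subinvariant E t v"
    and E: "\<And>i j. i \<noteq> c \<Longrightarrow> j \<noteq> c \<Longrightarrow> D i j \<le> E i j"
    and y: "\<And>i. y i \<le> Y" "y c = 1" "\<And>i j. D i j * y j \<le> r * y i"
    and q: "0 < q" "q < r" "\<And>j. D c j * y j \<le> q"
  obtains t' w where "0 < t'" "t' < r" "subinvariant D t' w"
proof -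
  have M0: "0 \<le> M" using nn M order_trans by blast
  obtain a b where ab: "0 < a" "\<And>i. a \<le> v i" "\<And>i. v i \<le> b"
    using v unfolding subinvariant_def by blast
  have vpos: "0 < v i" for i using ab(1) ab(2)[of i] by linarith
  have b: "0 < b" using ab(1) ab(2)[of 0] ab(3)[of 0] by linarith
  \<comment> \<open>The new entry at c, replacing v c. It is so small that column c contributes at
    most t a to any row, so z keeps level t in all rows but c.\<close>
  define \<epsilon> where "\<epsilon> = t * a / (M + 1)"
  have \<epsilon>: "0 < \<epsilon>" using t ab M0 by (simp add: \<epsilon>_def)
  have M\<epsilon>: "M * \<epsilon> \<le> t * a"
  proof -
    have "M * \<epsilon> \<le> (M + 1) * \<epsilon>" using \<epsilon> by simp
    also have "\<dots> = t * a" using M0 by (simp add: \<epsilon>_def)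
    finally show ?thesis .
  qed
  define z where "z i = (if i = c then \<epsilon> else v i)" for i
  have z: "0 < z i" "min a \<epsilon> \<le> z i" "z i \<le> max b \<epsilon>" for i
    using \<epsilon> vpos ab by (auto simp: z_def min_le_iff_disj le_max_iff_disj)
  have Dz: "D i j * z j \<le> t * z i" if "i \<noteq> c" for i j
  proof (cases "j = c")
    case True
    have "D i j * z j \<le> M * \<epsilon>" using True \<epsilon> M by (simp add: z_def)
    also have "\<dots> \<le> t * a" by (rule M\<epsilon>)
    also have "\<dots> \<le> t * z i" using that ab t by (simp add: z_def)
    finally show ?thesis .
  next
    case False
    have "D i j * v j \<le> E i j * v j" using E that False vpos[of j] by (simp add: mult_right_mono)
    also have "\<dots> \<le> t * v i" using v by (simp add: subinvariant_def)
    finally show ?thesis using that False by (simp add: z_def)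
  qed
  \<comment> \<open>In row c the vector z only satisfies some level L, which may exceed r; the
    choice of \<theta> makes up for this.\<close>
  define L where "L = (M * max b \<epsilon> + 1) / \<epsilon>"
  have Mm: "0 \<le> M * max b \<epsilon>" using M0 b by (simp add: le_max_iff_disj)
  have L: "0 < L" using Mm \<epsilon> by (simp add: L_def add_nonneg_pos)
  have Dzc': "D c j * z j \<le> M * max b \<epsilon>" for j
    using z(1)[of j] by (intro mult_mono M z(3) M0) auto
  have Dzc: "D c j * z j \<le> L * z c" for j
    using Dzc'[of j] \<epsilon> by (simp add: L_def z_def)
  \<comment> \<open>The mean has to be bounded away from 0, which y need not be. The multiple of z
    put under y is small enough to leave row c at level q.\<close>
  define \<delta> where "\<delta> = q / (M * max b \<epsilon> + 1)"
  have \<delta>: "0 < \<delta>" using q Mm by (simp add: \<delta>_def add_nonneg_pos)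
  have \<delta>c: "D c j * (\<delta> * z j) \<le> q" for j
  proof -
    have "D c j * (\<delta> * z j) = (D c j * z j) * \<delta>" by simp
    also have "\<dots> \<le> (M * max b \<epsilon> + 1) * \<delta>"
      using \<delta> Dzc'[of j] by (intro mult_right_mono) auto
    also have "\<dots> = q" using Mm by (simp add: \<delta>_def)
    finally show ?thesis .
  qed
  define x where "x i = (if i = c then 1 else max (y i) (\<delta> * z i))" for i
  have yx: "y i \<le> x i" for i by (simp add: x_def y)
  have x_or: "x j = y j \<or> x j = \<delta> * z j \<and> j \<noteq> c" for j
    by (auto simp: x_def y max_def)
  have Dxc: "D c j * x j \<le> q * x c" for j
    using x_or[of j] q(3)[of j] \<delta>c[of j] by (auto simp: x_def[of c])
  have Dx: "D i j * x j \<le> r * x i" if "i \<noteq> c" for i j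
    using x_or[of j]
  proof
    assume "x j = y j"
    moreover have "r * y i \<le> r * x i" using yx t by (intro mult_left_mono) auto
    ultimately show ?thesis using y(3)[of i j] by simp
  next
    assume "x j = \<delta> * z j \<and> j \<noteq> c"
    then have "D i j * x j = \<delta> * (D i j * z j)" by simp
    also have "\<dots> \<le> \<delta> * (t * z i)" using Dz[OF that, of j] \<delta> by simp
    also have "\<dots> \<le> \<delta> * (r * z i)" using t z(1)[of i] \<delta> by simp
    also have "\<dots> = r * (\<delta> * z i)" by simp
    also have "\<dots> \<le> r * x i" using that t by (simp add: x_def)
    finally show ?thesis .
  qed
  have x: "min 1 (\<delta> * min a \<epsilon>) \<le> x i" "x i \<le> max (max 1 Y) (\<delta> * max b \<epsilon>)" for i
  proof -
    have "\<delta> * min a \<epsilon> \<le> \<delta> * z i" "\<delta> * z i \<le> \<delta> * max b \<epsilon>"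
      using \<delta> z by (auto intro!: mult_left_mono)
    then show "min 1 (\<delta> * min a \<epsilon>) \<le> x i" "x i \<le> max (max 1 Y) (\<delta> * max b \<epsilon>)"
      using y(1)[of i] by (auto simp: x_def min_le_iff_disj le_max_iff_disj)
  qed
  have xm: "0 < min 1 (\<delta> * min a \<epsilon>)" using \<delta> ab \<epsilon> by simp
  have xpos: "0 < x i" for i using x(1)[of i] xm by linarith
  \<comment> \<open>As \<theta> tends to 1 the level of row c tends to q < r, and this fixes
    \<theta>. The other rows get level \<open>r powr \<theta> * t powr (1 - \<theta>)\<close>, which
    is below r for every \<theta> < 1.\<close>
  have "((\<lambda>\<theta>. q powr \<theta> * L powr (1 - \<theta>)) \<longlongrightarrow> q powr 1 * L powr (1 - 1)) (at_left 1)"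
    using q L by (intro tendsto_intros) auto
  then have "\<forall>\<^sub>F \<theta> in at_left 1. q powr \<theta> * L powr (1 - \<theta>) < r"
    using q L by (intro order_tendstoD(2)) auto
  moreover have "\<forall>\<^sub>F \<theta> in at_left 1. \<theta> \<in> {0<..<1::real}"
    by (rule eventually_at_leftI[of 0]) auto
  ultimately have "\<forall>\<^sub>F \<theta> in at_left 1. q powr \<theta> * L powr (1 - \<theta>) < r \<and> \<theta> \<in> {0<..<1::real}"
    by (rule eventually_conj)
  then obtain \<theta> where \<theta>: "q powr \<theta> * L powr (1 - \<theta>) < r" "0 < \<theta>" "\<theta> < 1"
    using eventually_happens[of _ "at_left (1::real)"] trivial_limit_at_left_real[of "1::real"] by auto
  define t' where "t' = max (r powr \<theta> * t powr (1 - \<theta>)) (q powr \<theta> * L powr (1 - \<theta>))"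
  have "t powr (1 - \<theta>) < r powr (1 - \<theta>)" using t \<theta> by (intro powr_less_mono2) auto
  then have "r powr \<theta> * t powr (1 - \<theta>) < r powr \<theta> * r powr (1 - \<theta>)"
    using t by (intro mult_strict_left_mono) auto
  also have "\<dots> = r" using t by (simp flip: powr_add)
  finally have t': "t' < r" "0 < t'" using \<theta> t q L by (auto simp: t'_def less_max_iff_disj)
  define w where "w i = x i powr \<theta> * z i powr (1 - \<theta>)" for i
  have wpos: "0 < w i" for i using xpos[of i] z(1)[of i] by (simp add: w_def)
  have Dw: "D i j * w j \<le> t' * w i" for i j
  proof (cases "i = c")
    case True
    have "D i j * w j \<le> (q powr \<theta> * L powr (1 - \<theta>)) * w i"
      unfolding w_def using True nn xpos z q L \<theta> Dxc Dzc by (intro geometric_mean_le) auto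
    also have "\<dots> \<le> t' * w i" using wpos[of i] by (simp add: t'_def)
    finally show ?thesis .
  next
    case False
    have "D i j * w j \<le> (r powr \<theta> * t powr (1 - \<theta>)) * w i"
      unfolding w_def using False nn xpos z t \<theta> Dx Dz by (intro geometric_mean_le) auto
    also have "\<dots> \<le> t' * w i" using wpos[of i] by (simp add: t'_def)
    finally show ?thesis .
  qed
  have "(min 1 (\<delta> * min a \<epsilon>)) powr \<theta> * (min a \<epsilon>) powr (1 - \<theta>) \<le> w i" for i
    unfolding w_def using x(1)[of i] z(2)[of i] xm ab \<epsilon> \<theta>
    by (intro mult_mono powr_mono2) auto
  moreover have "w i \<le> (max (max 1 Y) (\<delta> * max b \<epsilon>)) powr \<theta> * (max b \<epsilon>) powr (1 - \<theta>)" for i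
    unfolding w_def using x(2)[of i] z(3)[of i] z(1)[of i] xpos[of i] \<theta>
    by (intro mult_mono powr_mono2) auto
  moreover have "0 < (min 1 (\<delta> * min a \<epsilon>)) powr \<theta> * (min a \<epsilon>) powr (1 - \<theta>)"
    using xm ab \<epsilon> by (intro mult_pos_pos) auto
  ultimately have "subinvariant D t' w" using Dw unfolding subinvariant_def by blast
  then show thesis using t' by (intro that)
qed

section \<open>The eigenvector at level r(A)\<close>

theorem theorem3p9:
  fixes A :: inf_matrix
  assumes "A \<in> bounded_nonneg_matrices"
    and "max_ess_spectral_radius A < max_spectral_radius A"
  shows "max_spectral_radius A \<in> max_point_spectrum A"
proof -
  have nn: "0 \<le> A i j" for i j using assms(1) by (simp add: bounded_nonneg_matrices_def)
  obtain M where M: "A i j \<le> M" for i j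
    using assms(1) by (auto simp: bounded_nonneg_matrices_def bdd_above_def)
  have M0: "0 \<le> M" using nn[of 0 0] M[of 0 0] by linarith
  define r where "r = max_spectral_radius A"
  define B where "B n = tail_compression n A" for n
  define \<rho> where "\<rho> n = max_spectral_radius (B n)" for n
  have B0: "B 0 = A" by (simp add: B_def tail_compression_def)
  have Bnn: "0 \<le> B n i j" and BM: "B n i j \<le> M" and BSuc: "B (Suc n) i j \<le> B n i j" for n i j
    using nn M M0 by (auto simp: B_def tail_compression_def)
  have BA: "B n i j \<le> A i j" for n i j using nn by (simp add: B_def tail_compression_def)
  \<comment> \<open>Only row and column n distinguish \<open>B n\<close> from
    \<open>B (Suc n)\<close>, so n is the exceptional index c of \<open>subinvariant_extend\<close>
    and \<open>subinvariant_strict\<close>.\<close>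
  have Boff: "B n i j \<le> B (Suc n) i j" if "i \<noteq> n" "j \<noteq> n" for n i j
    using that by (simp add: B_def tail_compression_def)
  have \<rho>_nonneg: "0 \<le> \<rho> n"
    and \<rho>_le: "0 < t \<Longrightarrow> subinvariant (B n) t u \<Longrightarrow> \<rho> n \<le> t"
    and \<rho>_less: "\<rho> n < t \<Longrightarrow> \<exists>u. subinvariant (B n) t u" for n t u
    using max_spectral_radius_bounds[of "B n", OF Bnn BM] by (auto simp: \<rho>_def)
  have \<rho>_Suc: "\<rho> (Suc n) \<le> \<rho> n" for n
  proof (rule dense_ge)
    fix t assume "\<rho> n < t"
    then obtain u where "subinvariant (B n) t u" using \<rho>_less by blast
    then have "subinvariant (B (Suc n)) t u" by (rule subinvariant_mono) (simp_all add: BSuc)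
    moreover have "0 < t" using \<open>\<rho> n < t\<close> \<rho>_nonneg[of n] by linarith
    ultimately show "\<rho> (Suc n) \<le> t" using \<rho>_le by blast
  qed
  have dec: "decseq \<rho>" using \<rho>_Suc by (rule decseq_SucI)
  \<comment> \<open>Convergence has to be established before \<open>lim\<close> in
    \<open>max_ess_spectral_radius\<close> can be identified with the limit.\<close>
  obtain l where l: "\<rho> \<longlonglongrightarrow> l" using decseq_convergent[OF dec, of 0] \<rho>_nonneg by blast
  then have "l = max_ess_spectral_radius A"
    using limI[OF l] by (simp add: max_ess_spectral_radius_def \<rho>_def[abs_def] B_def)
  then have l_less: "l < r" using assms(2) by (simp add: r_def)
  have "0 \<le> l" using LIMSEQ_le_const[OF l] \<rho>_nonneg by blast
  then have r0: "0 < r" using l_less by simp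
  have \<rho>0: "\<rho> 0 = r" by (simp add: \<rho>_def B0 r_def)
  obtain N where N: "\<rho> N < r"
    using order_tendstoD(2)[OF l l_less] by (auto simp: eventually_sequentially)
  have "\<not> \<rho> 0 < r" using \<rho>0 by simp
  then obtain c where c: "\<rho> (Suc c) < r" "\<not> \<rho> c < r"
    using ex_least_nat_less[of "\<lambda>n. \<rho> n < r", OF N] by blast
  have \<rho>r: "\<rho> n \<le> r" for n using decseqD[OF dec, of 0 n] \<rho>0 by simp

  \<comment> \<open>Downward induction from \<open>Suc c\<close>, where r lies strictly above the
    radius. In each step the radius of \<open>B n\<close> is at most r, so all levels t > r are
    available.\<close>
  have "\<exists>u. subinvariant (B n) r u" if "n \<le> Suc c" for n
    using that
  proof (induction n rule: inc_induct)
    case base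
    show ?case using \<rho>_less c by blast
  next
    case (step n)
    then obtain v where v: "subinvariant (B (Suc n)) r v" by blast
    have "\<exists>u. subinvariant (B n) t u" if "r < t" for t
      using that \<rho>r[of n] by (intro \<rho>_less) simp
    then show ?case
      using subinvariant_extend[of "B n", OF Bnn BM r0 v Boff] by blast
  qed
  then obtain u where u: "subinvariant A r u" using B0 by force
  then obtain a b where ab: "0 < a" "\<And>i. a \<le> u i" "\<And>i. u i \<le> b"
    unfolding subinvariant_def by blast
  have upos: "0 < u i" for i using ab(1) ab(2)[of i] by linarith

  \<comment> \<open>No upper bound, and off c no positive lower bound, is imposed, so S contains its
    pointwise infimum and tolerates lowering a slack entry off c. The infimum is bounded because
    \<open>y0\<close> is.\<close>
  define S where "S = {y. (\<forall>i. 0 \<le> y i) \<and> 1 \<le> y c \<and> (\<forall>i j. A i j * y j \<le> r * y i)}"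
  define y0 where "y0 i = u i / u c" for i
  have y0: "y0 \<in> S"
  proof -
    have "A i j * y0 j \<le> r * y0 i" for i j
      using u upos[of c] divide_right_mono[of "A i j * u j" "r * u i" "u c"]
      by (simp add: y0_def subinvariant_def)
    moreover have "0 \<le> y0 i" for i using upos[of i] upos[of c] by (simp add: y0_def)
    moreover have "y0 c = 1" using upos[of c] by (simp add: y0_def)
    ultimately show ?thesis by (simp add: S_def)
  qed
  define x where "x i = (INF y\<in>S. y i)" for i
  have x_low: "x i \<le> y i" if "y \<in> S" for y i
    unfolding x_def by (rule cINF_lower) (use that in \<open>auto simp: S_def intro!: bdd_belowI2[of _ 0]\<close>)
  have x0: "0 \<le> x i" for i
    unfolding x_def using y0 by (intro cINF_greatest) (auto simp: S_def)
  have "1 \<le> x c"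
    unfolding x_def using y0 by (intro cINF_greatest) (auto simp: S_def)
  then have xc: "x c = 1" using x_low[OF y0, of c] upos[of c] by (simp add: y0_def)
  have xb: "x i \<le> b / u c" for i
    using x_low[OF y0, of i] ab(3)[of i] upos[of c]
    by (simp add: y0_def) (meson divide_right_mono less_imp_le order_trans)
  have Ax: "A i j * x j \<le> r * x i" for i j
  proof -
    have "A i j * x j / r \<le> y i" if "y \<in> S" for y
    proof -
      have "A i j * x j \<le> A i j * y j" using x_low[OF that] nn by (simp add: mult_left_mono)
      also have "\<dots> \<le> r * y i" using that by (simp add: S_def)
      finally show ?thesis using r0 by (simp add: field_simps)
    qed
    then have "A i j * x j / r \<le> x i" unfolding x_def[of i] using y0 by (intro cINF_greatest) auto
    then show ?thesis using r0 by (simp add: field_simps)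
  qed
  have up: "A i j * x j \<le> max_apply A x i" for i j
    unfolding max_apply_def by (rule cSUP_upper) (use Ax in \<open>auto intro!: bdd_aboveI\<close>)
  have le: "max_apply A x i \<le> r * x i" for i
    unfolding max_apply_def by (rule cSUP_least) (use Ax in auto)
  have nonneg: "0 \<le> max_apply A x i" for i
    using up[of i 0] mult_nonneg_nonneg[OF nn[of i 0] x0[of 0]] by linarith
  have "max_apply A x i = r * x i" for i
  proof (rule ccontr)
    assume "max_apply A x i \<noteq> r * x i"
    then have less: "max_apply A x i < r * x i" using le[of i] by simp
    show False
    proof (cases "i = c")
      case False
      \<comment> \<open>The new value is just what row i requires; the left sides of all rows can
        only drop, and the entry at c is untouched.\<close>
      define x' where "x' = x(i := max_apply A x i / r)"
      have x'i: "x' i < x i" using less r0 by (simp add: x'_def field_simps)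
      then have x'x: "x' j \<le> x j" for j by (cases "j = i") (auto simp: x'_def)
      have "A k j * x' j \<le> r * x' k" for k j
      proof -
        have "A k j * x' j \<le> A k j * x j" using x'x nn by (simp add: mult_left_mono)
        also have "\<dots> \<le> r * x' k" using up[of k j] Ax[of k j] r0 by (auto simp: x'_def)
        finally show ?thesis .
      qed
      then have "x' \<in> S" using x0 nonneg r0 xc False by (auto simp: S_def x'_def)
      then show False using x_low[of x' i] x'i by simp
    next
      case True
      \<comment> \<open>The midpoint with r, rather than the value of row c itself, is positive even
        if that value is 0.\<close>
      define q where "q = (max_apply A x c + r) / 2"
      have q: "max_apply A x c \<le> q" "0 < q" "q < r"
        using less nonneg[of c] r0 by (auto simp: q_def True xc)
      obtain t where t: "\<rho> (Suc c) < t" "t < r" using c dense by blast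
      have t0: "0 < t" using t \<rho>_nonneg[of "Suc c"] by linarith
      obtain v where v: "subinvariant (B (Suc c)) t v" using \<rho>_less t by blast
      \<comment> \<open>x was built for A; since \<open>B c\<close> \<le> A entrywise it serves
        \<open>B c\<close> as well, with the same slack in row c.\<close>
      have Bx: "B c i j * x j \<le> A i j * x j" for i j
        using BA x0 by (simp add: mult_right_mono)
      have Bx1: "B c i j * x j \<le> r * x i" for i j using Bx[of i j] Ax[of i j] by linarith
      have Bx2: "B c c j * x j \<le> q" for j using Bx[of c j] up[of c j] q by linarith
      obtain t' w where "0 < t'" "t' < r" "subinvariant (B c) t' w"
        by (rule subinvariant_strict[of "B c" M t r _ v c x "b / u c" q,
              OF Bnn BM t0 t(2) v Boff xb xc Bx1 q(2,3) Bx2])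
      then show False using \<rho>_le[of t' c w] c by simp
    qed
  qed
  moreover have "x \<in> linf_nonneg" using x0 xb by (auto simp: linf_nonneg_def intro!: bdd_aboveI)
  moreover have "x \<noteq> (\<lambda>_. 0)" using xc by (metis zero_neq_one)
  ultimately show ?thesis
    unfolding max_point_spectrum_def r_def[symmetric] using r0 by (auto intro!: bexI[of _ x])
qed

end
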